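(* For every span 4 surjective one-dimensional cellular automaton $f:\Sigma_2\to\Sigma_2$ on two symbols, the set of jointly periodic points of $f$ is (at least) 13-dense; that is, every word of length $13$ on the symbols $\{0,1\}$ occurs in some jointly periodic point of $f$.
   Context: $\Sigma_2=\{0,1\}^{\mathbb Z}$ is the set of doubly infinite sequences of symbols $0,1$, and $S_2:\Sigma_2\to\Sigma_2$ is the shift, $(S_2x)_i=x_{i+1}$. A one-dimensional cellular automaton on two symbols is a map $f:\Sigma_2\to\Sigma_2$ for which there are integers $a\le b$ and a function $F:\{0,1\}^{b-a+1}\to\{0,1\}$ such that $(f(x))_i=F(x_{i+a}\cdots x_{i+b})$ for all $x\in\Sigma_2$ and all $i\in\mathbb Z$. The local rule $F$ can be written as a polynomial modulo $2$ in the coordinate variables; the span of $f$ is $1$ plus the maximum difference between indices of coordinates which actually appear (with nonzero coefficient) in this polynomial. So a span 4 cellular automaton is one whose local rule depends on a window $x_{i+a},x_{i+a+1},x_{i+a+2},x_{i+a+3}$ of four consecutive coordinates, for some $a\in\mathbb Z$, genuinely depending on the first and the last of these. A point $x\in\Sigma_2$ is jointly periodic for $f$ if it is periodic under both maps: $S_2^k x=x$ for some $k\ge1$ and $f^n(x)=x$ for some $n\ge 1$. A subset $E\subset\Sigma_2$ is $m$-dense if for every word $w\in\{0,1\}^m$ there are a point $x\in E$ and an $i\in\mathbb Z$ with $x_ix_{i+1}\cdots x_{i+m-1}=w$. *)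

theory Defs
  imports Main "HOL-Library.Z2"
begin

text \<open>The symbols 0, 1 are the elements of the two-element field \<^typ>\<open>bit\<close>, so that sums and
  products of symbols are taken modulo 2.\<close>

type_synonym config = "int \<Rightarrow> bit"

definition shift :: "config \<Rightarrow> config" where
  "shift x = (\<lambda>i. x (i + 1))"

text \<open>Only the values of \<open>F\<close> on lists of length \<open>b - a + 1\<close> are relevant.\<close>

definition is_local_rule :: "(config \<Rightarrow> config) \<Rightarrow> int \<Rightarrow> int \<Rightarrow> (bit list \<Rightarrow> bit) \<Rightarrow> bool" where
  "is_local_rule f a b F \<longleftrightarrow> a \<le> b \<and> (\<forall>x i. f x i = F (map (\<lambda>j. x (i + j)) [a..b]))"

definition cellular_automaton :: "(config \<Rightarrow> config) \<Rightarrow> bool" where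
  "cellular_automaton f \<longleftrightarrow> (\<exists>a b F. is_local_rule f a b F)"

text \<open>Since every symbol satisfies \<open>t\<^sup>2 = t\<close>, polynomials modulo 2 are taken in reduced (square-free)
  form. Such a polynomial in the variables \<open>x j\<close> is encoded by the finite set of its monomials with
  nonzero coefficient, each monomial being the finite set of the indices of its variables (the
  empty set is the constant monomial 1).\<close>

type_synonym poly2 = "int set set"

definition eval_poly2 :: "poly2 \<Rightarrow> config \<Rightarrow> bit" where
  "eval_poly2 P x = (\<Sum>M\<in>P. \<Prod>j\<in>M. x j)"

definition is_rule_poly :: "int \<Rightarrow> int \<Rightarrow> (bit list \<Rightarrow> bit) \<Rightarrow> poly2 \<Rightarrow> bool" where
  "is_rule_poly a b F P \<longleftrightarrow> P \<subseteq> Pow {a..b} \<and> (\<forall>x. F (map x [a..b]) = eval_poly2 P x)"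

text \<open>The set \<open>\<Union>P\<close> consists of the indices of the variables that appear in \<open>P\<close>. The reduced polynomial
  is determined by \<open>f\<close>, so a map has at most one span. It is left without a span if its polynomial
  is constant, because there is then no index difference to maximise.\<close>

definition has_span :: "(config \<Rightarrow> config) \<Rightarrow> nat \<Rightarrow> bool" where
  "has_span f s \<longleftrightarrow> (\<exists>a b F P. is_local_rule f a b F \<and> is_rule_poly a b F P \<and> \<Union>P \<noteq> {} \<and>
     int s = 1 + Max {j - k | j k. j \<in> \<Union>P \<and> k \<in> \<Union>P})"

definition jointly_periodic :: "(config \<Rightarrow> config) \<Rightarrow> config \<Rightarrow> bool" where
  "jointly_periodic f x \<longleftrightarrow> (\<exists>k\<ge>1. (shift ^^ k) x = x) \<and> (\<exists>n\<ge>1. (f ^^ n) x = x)"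

definition m_dense :: "nat \<Rightarrow> config set \<Rightarrow> bool" where
  "m_dense m E \<longleftrightarrow>
     (\<forall>w :: bit list. length w = m \<longrightarrow> (\<exists>x\<in>E. \<exists>i. map (\<lambda>j. x (i + int j)) [0..<m] = w))"

end

theory Submission
  imports Defs Complex_Main
begin

text \<open>
The jointly periodic points of \<open>f\<close> are even dense, because every surjective map with a window of four
symbols is closing: \<open>f\<close> is one-to-one on the sequences with a given left half, or on those with a
given right half, and this with a bounded look-ahead.

For a right closing \<open>f\<close>, consider the fixed points of \<open>g = f \<circ> shift\<^sup>s\<close> for a large \<open>s\<close>. Each
symbol of a fixed point \<open>x\<close> is a function of symbols to its right, since \<open>x i = g x i\<close> is computed from
a window near \<open>i + s\<close>. Each symbol is also a function of symbols to its left, since \<open>f\<close> is closing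
and the image \<open>g x = x\<close> is known further than needed. So a window of bounded length determines the whole
fixed point, which is therefore periodic under the shift (\<open>fixed_point_periodic\<close>).
On such a point \<open>f\<close> acts as a power of the inverse of the shift, so the point is jointly periodic.

Fixed points containing a given word exist as soon as the window of \<open>g\<close> starts further ahead than the
length of the word plus the look-ahead of \<open>f\<close> (\<open>fixed_point_with_word\<close>). To the left of the word the
fixed-point equation is a recursion. To the right it asks for preimages of prescribed sequences that
continue a given past. A counting argument on the De Bruijn graph provides them
(\<open>readable_extend\<close>): for a closing rule, a readable word at least as long as the look-ahead can be
prolonged arbitrarily.

That surjective rules of width 4 are closing on one side, with a look-ahead of two symbols, is a
finite fact (\<open>diamond_or_closing\<close>): a rule of width 4 without this property has two
distinct words with common ends and the same image, and a surjective map has no such pair, by counting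
(\<open>surj_no_diamond\<close>). Left closing rules are reflections of right closing ones.
\<close>

section \<open>Words and their images\<close>

definition words :: "nat \<Rightarrow> bit list set" where
  "words n = {w. length w = n}"

lemma UNIV_bit: "(UNIV :: bit set) = {0, 1}"
  using bit.exhaust by blast

lemma card_words: "finite (words n)" "card (words n) = 2 ^ n"
proof -
  have *: "words n = {w. set w \<subseteq> (UNIV :: bit set) \<and> length w = n}"
    by (simp add: words_def)
  have "finite (UNIV :: bit set)" "card (UNIV :: bit set) = 2"
    by (simp_all add: UNIV_bit)
  then show "finite (words n)" "card (words n) = 2 ^ n"
    unfolding * by (simp_all only: finite_lists_length_eq card_lists_length_eq)
qed

fun image_word :: "nat \<Rightarrow> (bit list \<Rightarrow> bit) \<Rightarrow> bit list \<Rightarrow> bit list" where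
  "image_word r H [] = []"
| "image_word r H (a # w) =
    (if length w < r then [] else H (take (Suc r) (a # w)) # image_word r H w)"

lemma length_image_word [simp]: "length (image_word r H w) = length w - r"
  by (induction w) auto

lemma image_word_short: "length w \<le> r \<Longrightarrow> image_word r H w = []"
  using length_image_word[of r H w] by (metis diff_is_0_eq length_0_conv)

lemma image_word_overlap:
  "length c = r \<Longrightarrow> image_word r H (A @ c @ B) = image_word r H (A @ c) @ image_word r H (c @ B)"
  by (induction A) (auto simp: image_word_short)

lemma image_word_step:
  assumes "length u = r"
  shows "image_word r H (u @ c # v) = H (u @ [c]) # image_word r H (tl (u @ [c]) @ v)"
proof (cases u)
  case (Cons a u')
  then have "r = Suc (length u')" using assms by simp
  then show ?thesis using Cons by simp
qed (use assms in simp)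

lemma image_word_snoc:
  assumes "length w = n + r"
  shows "image_word r H (w @ [c]) = image_word r H w @ [H (drop n w @ [c])]"
proof -
  have "image_word r H (w @ [c]) = image_word r H (take n w @ drop n w @ [c])"
    by (metis append.assoc append_take_drop_id)
  also have "\<dots> = image_word r H w @ image_word r H (drop n w @ [c])"
    using assms by (subst image_word_overlap) simp_all
  also have "image_word r H (drop n w @ [c]) = [H (drop n w @ [c])]"
    using assms by (subst image_word_step) (simp_all add: image_word_short)
  finally show ?thesis .
qed

lemma image_word_take: "image_word r H (take (k + r) w) = take k (image_word r H w)"
proof (induction w arbitrary: k)
  case (Cons a w)
  show ?case
  proof (cases k)
    case (Suc j)
    show ?thesis using Cons[of j] Suc by (auto simp: min_def)
  qed (simp add: image_word_short)
qed simp

section \<open>Closing rules\<close>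

text \<open>The first symbol of a continuation \<open>v\<close> of \<open>u\<close> can be read off
  from \<open>u\<close> and the image, with \<open>d\<close> symbols of look-ahead. Rules that are
  permutive in the last variable are the case \<open>d = 0\<close>.\<close>

definition right_closing :: "nat \<Rightarrow> nat \<Rightarrow> (bit list \<Rightarrow> bit) \<Rightarrow> bool" where
  "right_closing r d H \<longleftrightarrow> (\<forall>u v v'. length u = r \<longrightarrow> length v = Suc d \<longrightarrow> length v' = Suc d \<longrightarrow>
     image_word r H (u @ v) = image_word r H (u @ v') \<longrightarrow> hd v = hd v')"

text \<open>In the De Bruijn graph whose edges carry the values of \<open>H\<close>, these are the
  labels of the paths of length \<open>n\<close> that start at the vertex \<open>u\<close>.\<close>

definition readable :: "nat \<Rightarrow> (bit list \<Rightarrow> bit) \<Rightarrow> nat \<Rightarrow> bit list \<Rightarrow> bit list set" where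
  "readable r H n u = (\<lambda>v. image_word r H (u @ v)) ` words n"

lemma finite_readable: "finite (readable r H n u)"
  by (simp add: readable_def card_words)

lemma words_Suc_Cons: "words (Suc n) = (\<lambda>(c, v). c # v) ` (UNIV \<times> words n)"
  by (auto simp: words_def image_iff length_Suc_conv)

lemma words_Suc_snoc: "words (Suc n) = (\<lambda>(v, c). v @ [c]) ` (words n \<times> UNIV)"
  by (auto simp: words_def image_iff length_Suc_conv_rev)

text \<open>Every vertex of the De Bruijn graph has two incoming edges.\<close>

lemma sum_over_successors:
  fixes N :: "bit list \<Rightarrow> nat"
  shows "(\<Sum>u\<in>words r. \<Sum>c\<in>UNIV. N (tl (u @ [c]))) = 2 * (\<Sum>u\<in>words r. N u)"
proof -
  have "(\<Sum>u\<in>words r. \<Sum>c\<in>UNIV. N (tl (u @ [c]))) = (\<Sum>z\<in>words (Suc r). N (tl z))"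
    unfolding words_Suc_snoc
    by (subst sum.reindex) (auto simp: inj_on_def sum.cartesian_product case_prod_unfold)
  also have "\<dots> = (\<Sum>c\<in>(UNIV :: bit set). \<Sum>u\<in>words r. N u)"
    unfolding words_Suc_Cons sum.cartesian_product
    by (subst sum.reindex) (auto simp: inj_on_def case_prod_unfold)
  also have "\<dots> = 2 * (\<Sum>u\<in>words r. N u)"
    by (simp add: UNIV_bit)
  finally show ?thesis .
qed

text \<open>Closing makes the union over the two outgoing edges disjoint: a label longer than the
  look-ahead determines the edge it starts with.\<close>

lemma card_readable_Suc:
  assumes "right_closing r d H" and "d \<le> n" and u: "length u = r"
  shows "card (readable r H (Suc n) u) = (\<Sum>c\<in>UNIV. card (readable r H n (tl (u @ [c]))))"
proof -
  let ?R = "\<lambda>c. (#) (H (u @ [c])) ` readable r H n (tl (u @ [c]))"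
  have eq: "readable r H (Suc n) u = (\<Union>c\<in>UNIV. ?R c)"
    unfolding readable_def words_Suc_Cons
    by (force simp: image_word_step[OF u])
  have disj: "?R c \<inter> ?R c' = {}" if "c \<noteq> c'" for c c'
  proof (rule ccontr)
    assume "?R c \<inter> ?R c' \<noteq> {}"
    then obtain v v' where v: "length v = n" "length v' = n"
      and "image_word r H (u @ c # v) = image_word r H (u @ c' # v')"
      unfolding readable_def words_def by (auto simp: image_word_step[OF u])
    then have "image_word r H (take (Suc d + r) (u @ c # v)) = image_word r H (take (Suc d + r) (u @ c' # v'))"
      unfolding image_word_take by simp
    then have "image_word r H (u @ c # take d v) = image_word r H (u @ c' # take d v')"
      using u by (simp add: take_Cons')
    then have "hd (c # take d v) = hd (c' # take d v')"
      using assms v unfolding right_closing_def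
      by (metis length_Cons length_take min_absorb2)
    with that show False by simp
  qed
  have "card (readable r H (Suc n) u) = (\<Sum>c\<in>UNIV. card (?R c))"
    unfolding eq by (rule card_UN_disjoint) (use disj in \<open>auto simp: UNIV_bit finite_readable\<close>)
  then show ?thesis
    by (simp add: card_image)
qed

lemma readable_Suc_subset:
  assumes "length u = r"
  shows "readable r H (Suc n) u \<subseteq> (\<lambda>(y, c). y @ [c]) ` (readable r H n u \<times> UNIV)"
  unfolding readable_def words_Suc_snoc using assms
  by (auto simp: image_iff words_def image_word_snoc[of "u @ _" n, simplified])

text \<open>A readable word that covers the look-ahead can be prolonged by either symbol. Passing
  from \<open>n\<close> to \<open>n + 1\<close> at most doubles the number of readable words at each
  vertex, because every one of them prolongs a readable word of length \<open>n\<close>. By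
  \<open>card_readable_Suc\<close> and \<open>sum_over_successors\<close> it exactly doubles the sum
  over all vertices. So it doubles at each vertex, which leaves no prolongation unreadable.\<close>

lemma readable_extend:
  assumes "right_closing r d H" and "d \<le> n" and u: "length u = r" and y: "y \<in> readable r H n u"
  shows "y @ [c] \<in> readable r H (Suc n) u"
proof -
  let ?E = "\<lambda>u. (\<lambda>(y, c). y @ [c]) ` (readable r H n u \<times> (UNIV :: bit set))"
  have fin: "finite (?E u)" for u
    by (simp add: finite_readable UNIV_bit)
  have "card (?E u) = card (readable r H n u \<times> (UNIV :: bit set))" for u
    by (rule card_image) (auto simp: inj_on_def)
  then have E: "card (?E u) = 2 * card (readable r H n u)" for u
    by (simp add: card_cartesian_product UNIV_bit)
  have "card (readable r H (Suc n) u) = card (?E u)"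
  proof (rule sum_mono_inv[where I = "words r"])
    have "(\<Sum>u\<in>words r. card (readable r H (Suc n) u))
      = (\<Sum>u\<in>words r. \<Sum>c\<in>UNIV. card (readable r H n (tl (u @ [c]))))"
      by (intro sum.cong refl card_readable_Suc[OF assms(1,2)]) (simp add: words_def)
    also have "\<dots> = 2 * (\<Sum>u\<in>words r. card (readable r H n u))"
      by (rule sum_over_successors)
    finally show "(\<Sum>u\<in>words r. card (readable r H (Suc n) u)) = (\<Sum>u\<in>words r. card (?E u))"
      unfolding E by (simp add: sum_distrib_left)
    show "card (readable r H (Suc n) u) \<le> card (?E u)" if "u \<in> words r" for u
      using that by (intro card_mono fin readable_Suc_subset) (simp add: words_def)
  qed (use u in \<open>simp_all add: words_def card_words(1)[unfolded words_def]\<close>)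
  then have "readable r H (Suc n) u = ?E u"
    using readable_Suc_subset[OF u] fin by (intro card_subset_eq) auto
  then show ?thesis using y by auto
qed

section \<open>Sliding block codes\<close>

definition window :: "config \<Rightarrow> int \<Rightarrow> nat \<Rightarrow> bit list" where
  "window x i n = map (\<lambda>j. x (i + int j)) [0..<n]"

definition sliding_block_code :: "nat \<Rightarrow> (bit list \<Rightarrow> bit) \<Rightarrow> int \<Rightarrow> config \<Rightarrow> config" where
  "sliding_block_code r H s x = (\<lambda>i. H (window x (i + s) (Suc r)))"

lemma length_window [simp]: "length (window x i n) = n"
  by (simp add: window_def)

lemma window_Suc: "window x i (Suc n) = x i # window x (i + 1) n"
  unfolding window_def by (simp add: upt_conv_Cons map_Suc_upt[symmetric] add_ac del: upt_Suc)

lemma window_0 [simp]: "window x i 0 = []"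
  by (simp add: window_def)

lemma window_add: "window x i (m + n) = window x i m @ window x (i + int m) n"
  by (induction m arbitrary: i) (auto simp: window_Suc add_ac)

lemma nth_window: "j < n \<Longrightarrow> window x i n ! j = x (i + int j)"
  by (simp add: window_def)

lemma window_eq_iff:
  "window x i n = window y k n \<longleftrightarrow> (\<forall>j<n. x (i + int j) = y (k + int j))"
  by (auto simp: list_eq_iff_nth_eq nth_window)

lemma window_cong:
  assumes "\<And>j. i \<le> j \<Longrightarrow> j < i + int n \<Longrightarrow> x j = y j"
  shows "window x i n = window y i n"
  using assms by (simp add: window_eq_iff)

lemma window_eqD:
  assumes "window x i n = window y i n" and "i \<le> j" and "j < i + int n"
  shows "x j = y j"
  using assms(1)[unfolded window_eq_iff, rule_format, of "nat (j - i)"] assms(2,3) by simp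

lemma window_surj:
  assumes "length w = n"
  obtains x where "window x i n = w"
proof
  show "window (\<lambda>j. w ! nat (j - i)) i n = w"
    using assms by (simp add: list_eq_iff_nth_eq nth_window)
qed

lemma sliding_block_code_cong:
  assumes "\<And>j. i + s \<le> j \<Longrightarrow> j \<le> i + s + int r \<Longrightarrow> x j = y j"
  shows "sliding_block_code r H s x i = sliding_block_code r H s y i"
  unfolding sliding_block_code_def by (rule arg_cong[of _ _ H], rule window_cong) (use assms in auto)

lemma image_word_window:
  "image_word r H (window x (i + s) (r + n)) = window (sliding_block_code r H s x) i n"
proof (induction n arbitrary: i)
  case (Suc n)
  have "image_word r H (window x (i + s) (r + Suc n))
    = H (take (Suc r) (window x (i + s) (Suc r + n))) # image_word r H (window x (i + 1 + s) (r + n))"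
    by (simp add: window_Suc add_ac)
  also have "take (Suc r) (window x (i + s) (Suc r + n)) = window x (i + s) (Suc r)"
    unfolding window_add by simp
  finally show ?case
    using Suc fun_cong[OF sliding_block_code_def[of r H s x], of i]
    by (simp only: window_Suc[of "sliding_block_code r H s x"])
qed (simp add: image_word_short)

lemma funpow_shift: "(shift ^^ k) x = (\<lambda>i. x (i + int k))"
  by (induction k arbitrary: x) (auto simp: shift_def funpow_Suc_right add_ac simp del: funpow.simps)

lemma window_shift: "window ((shift ^^ k) x) i n = window x (i + int k) n"
  by (simp add: window_def funpow_shift add_ac)

lemma sliding_block_code_shift:
  "sliding_block_code r H s ((shift ^^ k) x) = (shift ^^ k) (sliding_block_code r H s x)"
proof
  fix i
  have "window ((shift ^^ k) x) (i + s) (Suc r) = window x (i + int k + s) (Suc r)"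
    by (simp only: window_shift add_ac)
  then show "sliding_block_code r H s ((shift ^^ k) x) i = (shift ^^ k) (sliding_block_code r H s x) i"
    by (simp only: sliding_block_code_def funpow_shift)
qed

section \<open>Fixed points of shifted closing codes\<close>

text \<open>If the image of \<open>x\<close> is as prescribed up to \<open>p\<close>, it can be
  corrected at \<open>p + 1\<close> without touching \<open>x\<close> far to the left. The last
  \<open>d\<close> prescribed symbols are a readable word, which \<open>readable_extend\<close>
  prolongs by the desired symbol. When \<open>s\<close> is large, the rule looks so far ahead that
  the part of \<open>x\<close> that is kept reaches beyond \<open>p + 1\<close>.\<close>

lemma fixed_point_step:
  assumes closing: "right_closing r d H"
    and known: "\<And>i. i \<le> p \<Longrightarrow> sliding_block_code r H s x i = y i"
  obtains x' where "\<And>i. i \<le> p + s + int r - int d \<Longrightarrow> x' i = x i"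
    and "\<And>i. i \<le> p + 1 \<Longrightarrow> sliding_block_code r H s x' i = y i"
proof -
  \<comment> \<open>\<open>t\<close> is where the last \<open>d\<close> prescribed image symbols begin, \<open>q\<close> the first position that may change.\<close>
  define t where "t = p - int d + 1"
  define q where "q = t + s + int r"
  let ?u = "window x (t + s) r"
  let ?g = "sliding_block_code r H s"
  have "image_word r H (?u @ window x q d) \<in> readable r H d ?u"
    by (auto simp: readable_def words_def)
  then have "image_word r H (?u @ window x q d) @ [y (p + 1)] \<in> readable r H (Suc d) ?u"
    by (intro readable_extend[OF closing]) simp_all
  moreover have "?u @ window x q d = window x (t + s) (r + d)"
    unfolding window_add q_def by simp
  ultimately obtain v where v: "length v = Suc d"
    and image_v: "image_word r H (?u @ v) = window (?g x) t d @ [y (p + 1)]"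
    by (auto simp: readable_def words_def image_word_window)
  obtain z where z: "window z q (Suc d) = v"
    using window_surj[OF v] by blast
  define x' where "x' i = (if i < q then x i else z i)" for i
  show thesis
  proof
    show same: "x' i = x i" if "i \<le> p + s + int r - int d" for i
      using that unfolding x'_def q_def t_def by auto
    have "window x' (t + s) (r + Suc d) = window x' (t + s) r @ window x' q (Suc d)"
      unfolding window_add q_def by simp
    also have "window x' (t + s) r = ?u"
      by (rule window_cong) (auto simp: x'_def q_def)
    also have "window x' q (Suc d) = v"
      unfolding z[symmetric] by (rule window_cong) (auto simp: x'_def)
    finally have "window (?g x') t (Suc d) = window (?g x) t d @ [y (p + 1)]"
      using image_v by (simp flip: image_word_window)
    also have "window (?g x) t d = window y t d"
      by (rule window_cong) (simp add: known t_def)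
    also have "window y t d @ [y (p + 1)] = window y t (d + 1)"
      unfolding window_add by (simp add: window_Suc t_def)
    finally have new: "window (?g x') t (Suc d) = window y t (Suc d)" by simp
    show "?g x' i = y i" if "i \<le> p + 1" for i
    proof (cases "i < t")
      case True
      then have "?g x' i = ?g x i"
        by (intro sliding_block_code_cong same) (auto simp: t_def)
      with True show ?thesis using known by (simp add: t_def)
    next
      case False
      then show ?thesis using window_eqD[OF new] that by (simp add: t_def)
    qed
  qed
qed

text \<open>The unique sequence that agrees with \<open>z\<close> on the nonnegative positions and
  is fixed, at the negative ones, by the block code with offset \<open>s + 1\<close>. The recursion
  runs leftwards, so the offset must be positive.\<close>

function extend_left :: "(bit list \<Rightarrow> bit) \<Rightarrow> nat \<Rightarrow> nat \<Rightarrow> config \<Rightarrow> config" where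
  "extend_left H r s z i =
    (if 0 \<le> i then z i else H (map (\<lambda>j. extend_left H r s z (i + 1 + int s + int j)) [0..<Suc r]))"
  by pat_completeness auto
termination
  by (relation "measure (\<lambda>(H, r, s, z, i). nat (- i))") auto
declare extend_left.simps [simp del]

text \<open>Start from a point that contains \<open>w\<close> at \<open>0\<close> and is fixed to
  the left of it, and repair the fixed-point equation from left to right. The repair at position
  \<open>p + 1\<close> prescribes the current point as its own image, and the repaired point is
  unchanged up to \<open>p + 1\<close> and on the word \<open>w\<close>. So the fixed-point equation
  now holds up to \<open>p + 1\<close>, and the repairs converge.\<close>

lemma fixed_point_with_word:
  assumes closing: "right_closing r d H" and s: "int d + int m < s" and w: "length w = m"
  obtains x where "sliding_block_code r H s x = x" and "window x 0 m = w"
proof -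
  let ?g = "sliding_block_code r H s"
  \<comment> \<open>\<open>P k x\<close>: the point after \<open>k\<close> repairs; \<open>Q k x x'\<close>: what the next repair preserves.\<close>
  define P where "P k x \<longleftrightarrow> (\<forall>i < int k. ?g x i = x i) \<and> window x 0 m = w" for k x
  define Q where "Q k x x' \<longleftrightarrow> (\<forall>i \<le> int k. x' i = x i)" for k and x x' :: config
  obtain z where z: "window z 0 m = w"
    using window_surj[OF w] by blast
  let ?x0 = "extend_left H r (nat (s - 1)) z"
  have "?g ?x0 i = ?x0 i" if "i < 0" for i
    using that s by (simp add: extend_left.simps[of H r "nat (s - 1)" z i] sliding_block_code_def window_def add_ac del: upt_Suc)
  moreover have "window ?x0 0 m = w"
    unfolding z[symmetric] by (rule window_cong) (simp add: extend_left.simps)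
  ultimately have "P 0 ?x0" by (simp add: P_def)
  moreover have "\<exists>x'. P (Suc k) x' \<and> Q k x x'" if "P k x" for x k
  proof -
    have "?g x i = x i" if "i \<le> int k - 1" for i
      using that \<open>P k x\<close> by (simp add: P_def)
    then obtain x' where same: "\<And>i. i \<le> int k - 1 + s + int r - int d \<Longrightarrow> x' i = x i"
      and new: "\<And>i. i \<le> int k - 1 + 1 \<Longrightarrow> ?g x' i = x i"
      using fixed_point_step[OF closing, of "int k - 1" s x x] by blast
    have same': "x' i = x i" if "i \<le> int k + int m" for i
      using that s by (intro same) simp
    have "window x' 0 m = window x 0 m"
      by (rule window_cong) (simp add: same')
    then show ?thesis
      using new same' \<open>P k x\<close> unfolding P_def Q_def by (intro exI[of _ x']) auto
  qed
  ultimately obtain X where "\<forall>k. P k (X k) \<and> Q k (X k) (X (Suc k))"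
    using dependent_nat_choice[of P Q] by blast
  then have fixed: "\<And>k i. i < int k \<Longrightarrow> ?g (X k) i = X k i"
    and word: "\<And>k. window (X k) 0 m = w"
    and step: "\<And>k i. i \<le> int k \<Longrightarrow> X (Suc k) i = X k i"
    unfolding P_def Q_def by auto
  define x where "x i = X (nat i) i" for i
  have stable: "X k i = x i" if "i \<le> int k" for k i
  proof -
    have "nat i \<le> k" using that by simp
    then show ?thesis
      unfolding x_def by (induction k rule: dec_induct) (simp_all add: step)
  qed
  show thesis
  proof
    show "?g x = x"
    proof
      fix i
      define k where "k = nat (\<bar>i\<bar> + \<bar>s\<bar> + int r + 1)"
      have "?g x i = ?g (X k) i"
        by (rule sliding_block_code_cong) (simp add: stable k_def)
      also have "\<dots> = X k i" by (rule fixed) (simp add: k_def)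
      also have "\<dots> = x i" by (rule stable) (simp add: k_def)
      finally show "?g x i = x i" .
    qed
    have "window x 0 m = window (X m) 0 m"
      by (rule window_cong) (simp add: stable)
    then show "window x 0 m = w" by (simp add: word)
  qed
qed

text \<open>A fixed point propagates in both directions: to the left because each symbol is a
  function of later ones, to the right because the already known part is also a known image, which
  reaches past the look-ahead and so reveals the next symbol.\<close>

lemma fixed_points_determined_by_window:
  assumes closing: "right_closing r d H" and s: "int d < s"
    and x: "sliding_block_code r H s x = x" and y: "sliding_block_code r H s y = y"
    and agree: "window x p (nat s + r) = window y p (nat s + r)"
  shows "x = y"
proof -
  let ?g = "sliding_block_code r H s"
  define e where "e = p + s + int r"
  have left: "\<forall>i. e - int n \<le> i \<longrightarrow> i < e \<longrightarrow> x i = y i" for n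
  proof (induction n)
    case (Suc n)
    have "x i = y i" if "e - int (Suc n) \<le> i" "i < e" for i
    proof (cases "p \<le> i")
      case True
      then show ?thesis
        using window_eqD[OF agree True] that s by (simp add: e_def)
    next
      case False
      have "?g x i = ?g y i"
        by (rule sliding_block_code_cong) (use Suc False that s in \<open>auto simp: e_def\<close>)
      then show ?thesis by (simp add: x y)
    qed
    then show ?case by blast
  qed simp
  have right: "\<forall>i < e + int n. x i = y i" for n
  proof (induction n)
    case 0
    show ?case
    proof (intro allI impI)
      fix i assume "i < e + int 0"
      then show "x i = y i" using left[of "nat (e - i)"] by simp
    qed
  next
    case (Suc n)
    let ?q = "e + int n"
    define t where "t = ?q - s - int r"
    have word: "window z (t + s) r @ window z ?q (Suc d) = window z (t + s) (r + Suc d)" for z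
      unfolding window_add by (simp add: t_def)
    have "window x t (Suc d) = window y t (Suc d)"
      by (rule window_cong) (use Suc s in \<open>simp add: t_def\<close>)
    then have "image_word r H (window x (t + s) r @ window x ?q (Suc d))
      = image_word r H (window y (t + s) r @ window y ?q (Suc d))"
      unfolding word image_word_window x y .
    moreover have "window x (t + s) r = window y (t + s) r"
      by (rule window_cong) (use Suc in \<open>simp add: t_def\<close>)
    ultimately have "hd (window x ?q (Suc d)) = hd (window y ?q (Suc d))"
      using closing unfolding right_closing_def by (metis length_window)
    then have "x ?q = y ?q" by (simp add: window_Suc)
    then have "x i = y i" if "i \<le> ?q" for i
      using Suc that by (cases "i = ?q") simp_all
    then show ?case by simp
  qed
  show "x = y"
  proof
    fix i show "x i = y i" using right[of "nat (i - e + 1)"] by auto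
  qed
qed

text \<open>Some window occurs twice, and a translate of a fixed point is a fixed point.\<close>

lemma fixed_point_periodic:
  assumes "right_closing r d H" and "int d < s" and x: "sliding_block_code r H s x = x"
  shows "\<exists>k\<ge>1. (shift ^^ k) x = x"
proof -
  let ?L = "nat s + r"
  have "finite (range (\<lambda>k :: nat. window x (int k) ?L))"
    by (rule finite_subset[OF _ card_words(1)[of ?L]]) (auto simp: words_def)
  then have "\<not> inj (\<lambda>k :: nat. window x (int k) ?L)"
    using finite_imageD infinite_UNIV_nat by blast
  then obtain a b :: nat where "a < b" and ab: "window x (int a) ?L = window x (int b) ?L"
    by (metis (no_types, lifting) injI linorder_neqE_nat)
  let ?y = "(shift ^^ (b - a)) x"
  have "window ?y (int a) ?L = window x (int a) ?L"
    using ab \<open>a < b\<close> by (simp add: window_shift)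
  then have "?y = x"
    by (intro fixed_points_determined_by_window[OF assms(1,2) _ x])
      (simp_all add: sliding_block_code_shift x)
  then show ?thesis using \<open>a < b\<close> by (intro exI[of _ "b - a"]) simp
qed

text \<open>The hypothesis says that \<open>f\<close> acts on \<open>x\<close> as a power of the
  inverse of the shift, so \<open>f ^^ k\<close> moves \<open>x\<close> by a multiple of its
  period.\<close>

lemma jointly_periodic_if_shifted_fixed_point:
  assumes comm: "\<And>k x. f ((shift ^^ k) x) = (shift ^^ k) (f x)"
    and fixed: "(shift ^^ e) (f x) = x" and k: "k \<ge> 1" "(shift ^^ k) x = x"
  shows "jointly_periodic f x"
proof -
  have comm': "(f ^^ n) ((shift ^^ j) z) = (shift ^^ j) ((f ^^ n) z)" for n j z
    by (induction n) (simp_all add: comm)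
  have iter: "(shift ^^ (e * n)) ((f ^^ n) x) = x" for n
  proof (induction n)
    case (Suc n)
    have "(shift ^^ (e * Suc n)) ((f ^^ Suc n) x) = (shift ^^ (e * n)) ((f ^^ n) ((shift ^^ e) (f x)))"
      unfolding mult_Suc_right add.commute[of e] funpow_add
      by (simp only: comm' funpow_Suc_right comp_apply)
    then show ?case using Suc fixed by simp
  qed simp
  have per: "(shift ^^ (k * n)) x = x" for n
    by (induction n) (simp_all add: funpow_add k)
  have "(f ^^ k) x = (f ^^ k) ((shift ^^ (e * k)) x)"
    using per[of e] by (simp add: mult.commute)
  also have "\<dots> = x" using iter[of k] by (simp add: comm')
  finally show ?thesis using k unfolding jointly_periodic_def by blast
qed

text \<open>Composing with a power of the shift changes the offset \<open>a\<close> into an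
  arbitrarily large \<open>s\<close>.\<close>

lemma right_closing_dense:
  assumes closing: "right_closing r d H"
  shows "m_dense m {x. jointly_periodic (sliding_block_code r H a) x}"
  unfolding m_dense_def
proof (intro allI impI)
  fix w :: "bit list" assume w: "length w = m"
  let ?f = "sliding_block_code r H a"
  define s where "s = int d + int m + 1 + \<bar>a\<bar>"
  obtain x where x: "sliding_block_code r H s x = x" and word: "window x 0 m = w"
    by (rule fixed_point_with_word[OF closing _ w, of s]) (simp_all add: s_def)
  have "int (nat (s - a)) = s - a" by (simp add: s_def)
  then have "(shift ^^ nat (s - a)) (?f x) = sliding_block_code r H s x"
    by (simp add: fun_eq_iff funpow_shift sliding_block_code_def)
  moreover have "int d < s" by (simp add: s_def)
  then obtain k where "k \<ge> 1" "(shift ^^ k) x = x"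
    using fixed_point_periodic[OF closing _ x] by blast
  ultimately have "jointly_periodic ?f x"
    using x by (intro jointly_periodic_if_shifted_fixed_point[of ?f "nat (s - a)" x k])
      (simp_all add: sliding_block_code_shift)
  then show "\<exists>x\<in>{x. jointly_periodic ?f x}. \<exists>i. map (\<lambda>j. x (i + int j)) [0..<m] = w"
    using word unfolding window_def by blast
qed

section \<open>Reflection\<close>

definition reflect :: "config \<Rightarrow> config" where
  "reflect x = (\<lambda>i. x (- i))"

lemma window_reflect: "window (reflect x) i n = rev (window x (- (i + int n - 1)) n)"
  by (rule nth_equalityI) (auto simp: nth_window rev_nth reflect_def of_nat_diff algebra_simps)

lemma sliding_block_code_reflect:
  "sliding_block_code r H s (reflect x)
    = reflect (sliding_block_code r (\<lambda>w. H (rev w)) (- (s + int r)) x)"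
proof
  fix i
  have "- (i + s + int (Suc r) - 1) = - i + - (s + int r)" by simp
  then have "window (reflect x) (i + s) (Suc r) = rev (window x (- i + - (s + int r)) (Suc r))"
    unfolding window_reflect by (rule arg_cong)
  then show "sliding_block_code r H s (reflect x) i
    = reflect (sliding_block_code r (\<lambda>w. H (rev w)) (- (s + int r)) x) i"
    unfolding sliding_block_code_def reflect_def[of "\<lambda>i. H (rev (window x (i + - (s + int r)) (Suc r)))"]
    by (rule arg_cong)
qed

lemma jointly_periodic_reflect:
  assumes f: "\<And>x. f (reflect x) = reflect (g x)" and x: "jointly_periodic g x"
  shows "jointly_periodic f (reflect x)"
proof -
  obtain k n where k: "k \<ge> 1" "(shift ^^ k) x = x" and n: "n \<ge> 1" "(g ^^ n) x = x"
    using x by (auto simp: jointly_periodic_def)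
  have "(f ^^ n) (reflect x) = reflect ((g ^^ n) x)" for n
    by (induction n) (simp_all add: f)
  moreover have "(shift ^^ k) (reflect x) = reflect x"
  proof
    fix i
    show "(shift ^^ k) (reflect x) i = reflect x i"
      using fun_cong[OF k(2), of "- (i + int k)"] by (simp add: funpow_shift reflect_def)
  qed
  ultimately show ?thesis
    using k n unfolding jointly_periodic_def by auto
qed

lemma left_closing_dense:
  assumes "right_closing r d (\<lambda>w. H (rev w))"
  shows "m_dense m {x. jointly_periodic (sliding_block_code r H a) x}"
  unfolding m_dense_def
proof (intro allI impI)
  fix w :: "bit list" assume w: "length w = m"
  let ?f = "sliding_block_code r H a"
  let ?g = "sliding_block_code r (\<lambda>w. H (rev w)) (- (a + int r))"
  obtain x i where x: "jointly_periodic ?g x" and word: "window x i m = rev w"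
    using right_closing_dense[OF assms, of m "- (a + int r)"] w
    unfolding m_dense_def window_def[symmetric] by (metis length_rev mem_Collect_eq)
  have "jointly_periodic ?f (reflect x)"
    by (rule jointly_periodic_reflect[OF sliding_block_code_reflect x])
  moreover have "window (reflect x) (- (i + int m - 1)) m = w"
    using word by (simp add: window_reflect)
  ultimately show "\<exists>x\<in>{x. jointly_periodic ?f x}. \<exists>i. map (\<lambda>j. x (i + int j)) [0..<m] = w"
    unfolding window_def by blast
qed

section \<open>Surjective codes identify no diamonds\<close>

text \<open>Once two such words have the same image, they can be exchanged inside any longer word
  without changing its image: the common ends of length \<open>r\<close> hide the exchange from the
  surrounding symbols.\<close>

definition diamond :: "nat \<Rightarrow> bit list \<Rightarrow> bit list \<Rightarrow> bool" where
  "diamond r P Q \<longleftrightarrow> length P = length Q \<and> r \<le> length P \<and> P \<noteq> Q \<and>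
     take r P = take r Q \<and> drop (length P - r) P = drop (length Q - r) Q"

lemma diamond_exchange:
  assumes "diamond r P Q" and eq: "image_word r H P = image_word r H Q"
  shows "image_word r H (A @ P @ B) = image_word r H (A @ Q @ B)"
proof -
  let ?c = "take r P" and ?e = "drop (length P - r) P"
  have split: "image_word r H (A @ R @ B) = image_word r H (A @ ?c) @ image_word r H R @ image_word r H (?e @ B)"
    if "length R = length P" "take r R = ?c" "drop (length P - r) R = ?e" for R
  proof -
    have lens: "length ?c = r" "length ?e = r"
      using assms by (simp_all add: diamond_def)
    have "image_word r H (A @ R @ B) = image_word r H (A @ ?c @ drop r R @ B)"
      using that(2) by (metis append.assoc append_take_drop_id)
    also have "\<dots> = image_word r H (A @ ?c) @ image_word r H (R @ B)"
      using that(2) by (metis append.assoc append_take_drop_id image_word_overlap lens(1))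
    also have "image_word r H (R @ B) = image_word r H (take (length P - r) R @ ?e @ B)"
      using that(3) by (metis append.assoc append_take_drop_id)
    also have "\<dots> = image_word r H R @ image_word r H (?e @ B)"
      using that(3) by (metis append_take_drop_id image_word_overlap lens(2))
    finally show ?thesis .
  qed
  show ?thesis
    using split[of P] split[of Q] assms unfolding diamond_def by metis
qed

lemma words_mult: "words (k * n) \<subseteq> concat ` {bs. set bs \<subseteq> words n \<and> length bs = k}"
proof (induction k)
  case (Suc k)
  show ?case
  proof
    fix w assume w: "w \<in> words (Suc k * n)"
    then have "drop n w \<in> words (k * n)" by (simp add: words_def)
    then obtain bs where "set bs \<subseteq> words n" "length bs = k" "concat bs = drop n w"
      using Suc by force
    with w show "w \<in> concat ` {bs. set bs \<subseteq> words n \<and> length bs = Suc k}"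
      by (intro image_eqI[of _ _ "take n w # bs"]) (auto simp: words_def)
  qed
qed (auto simp: words_def intro!: image_eqI[of _ _ "[]"])

lemma surj_image_word:
  assumes "surj (sliding_block_code r H s)" and "length y = n"
  obtains w where "length w = r + n" and "image_word r H w = y"
proof -
  obtain z where z: "window z 0 n = y" using window_surj[OF assms(2)] .
  obtain x where "sliding_block_code r H s x = z" using assms(1) by (metis surjD)
  then show thesis
    using that[of "window x (0 + s) (r + n)"] z unfolding image_word_window by simp
qed

text \<open>This is Moore's half of the Garden of Eden theorem. If \<open>P\<close> and
  \<open>Q\<close>, of length \<open>n\<close>, have the same image, then all images of words of
  length \<open>k * n\<close> are images of words in whose division into \<open>k\<close> blocks
  \<open>P\<close> does not occur. There are \<open>(2 ^ n - 1) ^ k\<close> such words, for large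
  \<open>k\<close> fewer than the \<open>2 ^ (k * n - r)\<close> words that a surjective code has to
  produce.\<close>

lemma surj_no_diamond:
  assumes surj: "surj (sliding_block_code r H s)" and PQ: "diamond r P Q"
  shows "image_word r H P \<noteq> image_word r H Q"
proof
  assume eq: "image_word r H P = image_word r H Q"
  define n where "n = length P"
  define M where "M = 2 ^ n - (1 :: nat)"
  define exchange where "exchange b = (if b = P then Q else b)" for b
  have n: "0 < n" "r \<le> n" and P: "P \<in> words n" and Q: "Q \<in> words n"
    using PQ by (auto simp: diamond_def n_def words_def)
  have blocks: "image_word r H (A @ concat bs) = image_word r H (A @ concat (map exchange bs))" for A bs
  proof (induction bs arbitrary: A)
    case (Cons b bs)
    have "image_word r H (A @ b @ concat bs) = image_word r H (A @ exchange b @ concat bs)"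
      by (simp add: exchange_def diamond_exchange[OF PQ eq])
    then show ?case using Cons[of "A @ exchange b"] by simp
  qed simp
  have bound: "2 ^ (k * n) \<le> 2 ^ r * M ^ k" if "k \<noteq> 0" for k
  proof -
    let ?L = "{bs. set bs \<subseteq> words n - {P} \<and> length bs = k}"
    have rk: "r \<le> k * n"
      using n that by (metis le_trans mult_le_mono1 nat_mult_1 less_one linorder_not_le)
    have "words (k * n - r) \<subseteq> (\<lambda>bs. image_word r H (concat bs)) ` ?L"
    proof
      fix y assume "y \<in> words (k * n - r)"
      then obtain w where "length w = k * n" and w: "image_word r H w = y"
        using surj_image_word[OF surj, of y "k * n - r"] rk by (auto simp: words_def)
      then obtain bs where bs: "set bs \<subseteq> words n" "length bs = k" "concat bs = w"
        using words_mult[of k n] unfolding words_def by blast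
      have "y = image_word r H (concat (map exchange bs))"
        using blocks[of "[]" bs] bs w by simp
      moreover have "map exchange bs \<in> ?L"
        using bs P Q PQ by (auto simp: exchange_def diamond_def)
      ultimately show "y \<in> (\<lambda>bs. image_word r H (concat bs)) ` ?L" by blast
    qed
    moreover have fin: "finite (words n - {P})" "card (words n - {P}) = M"
      using P by (simp_all add: card_words M_def)
    moreover have "finite ?L"
      by (rule finite_lists_length_eq[OF fin(1)])
    ultimately have "card (words (k * n - r)) \<le> card ?L"
      by (meson surj_card_le)
    also have "card ?L = M ^ k"
      using card_lists_length_eq[OF fin(1)] fin(2) by simp
    finally have "2 ^ r * 2 ^ (k * n - r) \<le> 2 ^ r * M ^ k"
      by (simp add: card_words)
    then show ?thesis using rk by (simp flip: power_add)
  qed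
  have M: "0 < M" "M + 1 = 2 ^ n"
    using one_less_power[of "2 :: nat" n] n(1) by (simp_all add: M_def)
  obtain k where k: "2 ^ r < (real (M + 1) / real M) ^ k"
    using real_arch_pow[of "real (M + 1) / real M" "2 ^ r"] M(1) by (auto simp: field_simps)
  moreover have "(1 :: real) \<le> 2 ^ r" by simp
  ultimately have "k \<noteq> 0" by (intro notI) simp
  have "2 ^ (k * n) = (M + 1) ^ k"
    unfolding M(2) by (simp flip: power_mult add: mult.commute)
  then have "real (2 ^ r * M ^ k) < real (2 ^ (k * n))"
    using k M(1) by (simp add: power_divide field_simps)
  with bound[OF \<open>k \<noteq> 0\<close>] show False
    by (metis linorder_not_le of_nat_le_iff)
qed

section \<open>Rules of width 4\<close>

text \<open>In the De Bruijn graph, any two paths that start with the edges \<open>a\<close> and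
  \<open>b\<close> and take \<open>k\<close> further steps have different labels. The recursion
  follows both paths at once, which turns closing into a propositional formula in the values of the
  rule.\<close>

fun separated :: "(bit list \<Rightarrow> bit) \<Rightarrow> nat \<Rightarrow> bit list \<Rightarrow> bit list \<Rightarrow> bool" where
  "separated H 0 a b \<longleftrightarrow> H a \<noteq> H b"
| "separated H (Suc k) a b \<longleftrightarrow> H a \<noteq> H b \<or> (\<forall>i j. separated H k (tl a @ [i]) (tl b @ [j]))"

lemma separated_images_differ:
  assumes "separated H k a b" and "length a = Suc r" and "length b = Suc r"
    and "length v = k" and "length v' = k"
  shows "image_word r H (a @ v) \<noteq> image_word r H (b @ v')"
  using assms
proof (induction k arbitrary: a b v v')
  case 0
  then show ?case by (cases a; cases b) (simp_all add: image_word_short)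
next
  case (Suc k)
  obtain c v0 c' v0' where v: "v = c # v0" "v' = c' # v0'"
    using Suc.prems(4,5) by (metis length_Suc_conv)
  have image: "image_word r H (z @ e # y) = H z # image_word r H ((tl z @ [e]) @ y)"
    if "length z = Suc r" for z e y
    using that by (cases z) simp_all
  from Suc.prems(1) consider "H a \<noteq> H b" | "separated H k (tl a @ [c]) (tl b @ [c'])"
    by auto
  then show ?case
  proof cases
    case 2
    have "image_word r H ((tl a @ [c]) @ v0) \<noteq> image_word r H ((tl b @ [c']) @ v0')"
      by (rule Suc.IH[OF 2]) (use Suc.prems v in auto)
    then show ?thesis unfolding v using Suc.prems(2,3) by (simp only: image list.inject simp_thms)
  qed (use Suc.prems(2,3) v in \<open>simp add: image\<close>)
qed

lemma right_closing_if_separated: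
  assumes "\<And>u. length u = r \<Longrightarrow> separated H d (u @ [0]) (u @ [1])"
  shows "right_closing r d H"
  unfolding right_closing_def
proof (intro allI impI, rule ccontr)
  fix u v v' assume *: "length u = r" "length v = Suc d" "length v' = Suc d"
    "image_word r H (u @ v) = image_word r H (u @ v')" "hd v \<noteq> hd v'"
  have no: False if "length t = d" "length t' = d" "image_word r H (u @ 0 # t) = image_word r H (u @ 1 # t')" for t t'
    using separated_images_differ[OF assms[OF *(1)], of r t t'] that *(1) by simp
  obtain c t c' t' where v: "v = c # t" "v' = c' # t'"
    using *(2,3) by (metis length_Suc_conv)
  show False
    using * v no[of t t'] no[of t' t] by (cases c; cases c') simp_all
qed

text \<open>A family of diamonds such that every rule of width 4 gives the two words of one of them
  the same image or is closing on one side. The 91 listed pairs come from a greedy covering of the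
  rules that are closing on neither side, chosen together with their images under reversal and under
  exchange of the two symbols.\<close>

definition diamonds :: "(bit list \<times> bit list) list" where
  "diamonds = concat (map (\<lambda>(P, Q). [(P, Q), (rev P, rev Q), (map ((+) 1) P, map ((+) 1) Q),
     (map ((+) 1) (rev P), map ((+) 1) (rev Q))]) [
    ([0,0,0,0,0,1,0], [0,0,0,1,0,1,0]),
    ([0,0,0,0,1,0,1], [0,0,0,1,1,0,1]),
    ([0,0,0,0,1,1,0], [0,0,0,1,1,1,0]),
    ([0,0,1,0,0,0,1], [0,0,1,1,0,0,1]),
    ([0,0,1,0,1,0,0], [0,0,1,1,1,0,0]),
    ([0,0,1,0,1,0,1], [0,0,1,1,1,0,1]),
    ([0,0,1,0,1,1,0], [0,0,1,1,1,1,0]),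
    ([0,1,0,0,1,0,1], [0,1,0,1,1,0,1]),
    ([0,1,1,0,1,1,0], [0,1,1,1,1,1,0]),
    ([0,0,0,0,0,0,0,1], [0,0,0,1,1,0,0,1]),
    ([0,0,0,0,0,0,1,1], [0,0,0,1,1,0,1,1]),
    ([0,0,0,0,1,0,0,0], [0,0,0,1,0,0,0,0]),
    ([0,0,0,0,1,1,0,0], [0,0,0,1,0,1,0,0]),
    ([0,0,1,0,0,0,0,1], [0,0,1,1,1,0,0,1]),
    ([0,0,1,0,0,0,1,0], [0,0,1,1,1,0,1,0]),
    ([0,0,1,0,0,0,1,1], [0,0,1,1,1,0,1,1]),
    ([0,0,1,0,0,1,0,1], [0,0,1,1,1,1,0,1]),
    ([0,0,1,0,1,0,1,0], [0,0,1,1,0,0,1,0]),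
    ([0,0,1,0,1,0,1,1], [0,0,1,1,0,0,1,1]),
    ([0,1,0,0,0,0,0,1], [0,1,0,1,1,0,0,1]),
    ([0,1,0,0,0,1,0,1], [0,1,0,1,1,1,0,1]),
    ([0,1,0,0,1,0,0,1], [0,1,0,1,0,0,0,1]),
    ([0,1,0,0,1,1,1,0], [0,1,0,1,0,1,1,0]),
    ([0,1,1,0,1,0,0,1], [0,1,1,1,0,0,0,1]),
    ([0,1,1,0,1,1,1,0], [0,1,1,1,0,1,1,0]),
    ([0,0,0,0,0,0,0,0,1], [0,0,0,1,1,1,0,0,1]),
    ([0,0,0,0,0,0,0,1,1], [0,0,0,1,1,1,0,1,1]),
    ([0,0,0,0,0,0,1,0,0], [0,0,0,1,0,1,1,0,0]),
    ([0,0,0,0,0,1,0,0,0], [0,0,0,1,1,0,0,0,0]),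
    ([0,0,0,0,0,1,1,0,0], [0,0,0,1,1,0,1,0,0]),
    ([0,0,0,0,1,0,0,0,1], [0,0,0,1,0,1,0,0,1]),
    ([0,0,0,0,1,0,0,0,1], [0,0,0,1,1,1,0,0,1]),
    ([0,0,0,0,1,0,0,1,1], [0,0,0,1,1,1,0,1,1]),
    ([0,0,0,0,1,0,1,0,1], [0,0,0,1,0,1,1,0,1]),
    ([0,0,0,0,1,1,0,0,1], [0,0,0,1,0,0,0,0,1]),
    ([0,0,0,0,1,1,0,1,1], [0,0,0,1,1,0,0,1,1]),
    ([0,0,0,0,1,1,1,0,0], [0,0,0,1,0,0,1,0,0]),
    ([0,0,0,0,1,1,1,1,0], [0,0,0,1,1,0,1,1,0]),
    ([0,0,1,0,0,0,0,1,0], [0,0,1,1,1,1,0,1,0]),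
    ([0,0,1,0,0,1,0,1,0], [0,0,1,1,0,0,0,1,0]),
    ([0,0,1,0,0,1,0,1,1], [0,0,1,1,1,0,0,1,1]),
    ([0,0,1,0,0,1,1,0,1], [0,0,1,1,0,0,1,0,1]),
    ([0,0,1,0,1,0,0,0,1], [0,0,1,1,0,1,0,0,1]),
    ([0,0,1,0,1,1,0,0,1], [0,0,1,1,1,0,0,0,1]),
    ([0,0,1,0,1,1,0,1,0], [0,0,1,1,1,0,0,1,0]),
    ([0,1,0,0,0,1,0,0,1], [0,1,0,1,1,0,0,0,1]),
    ([0,1,0,0,0,1,1,0,1], [0,1,0,1,1,0,1,0,1]),
    ([0,1,0,0,1,0,0,1,0], [0,1,0,1,0,1,0,1,0]),
    ([0,1,0,0,1,0,1,1,0], [0,1,0,1,1,1,1,1,0]),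
    ([0,1,1,0,0,1,0,0,1], [0,1,1,1,1,0,0,0,1]),
    ([0,1,1,0,0,1,1,1,0], [0,1,1,1,0,0,1,1,0]),
    ([0,0,0,0,0,0,0,0,0,1], [0,0,0,1,0,0,1,0,0,1]),
    ([0,0,0,0,0,1,0,1,0,1], [0,0,0,1,1,0,1,1,0,1]),
    ([0,0,0,0,0,1,1,0,0,0], [0,0,0,1,0,1,0,0,0,0]),
    ([0,0,0,0,0,1,1,0,0,1], [0,0,0,1,1,1,0,0,0,1]),
    ([0,0,0,0,1,1,0,0,0,1], [0,0,0,1,0,0,1,0,0,1]),
    ([0,0,0,0,1,1,0,0,1,0], [0,0,0,1,1,1,1,0,1,0]),
    ([0,0,1,0,0,0,1,0,0,1], [0,0,1,1,0,1,0,0,0,1]),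
    ([0,0,1,0,0,0,1,1,0,0], [0,0,1,1,1,0,0,1,0,0]),
    ([0,0,1,0,0,0,1,1,0,0], [0,0,1,1,1,1,0,1,0,0]),
    ([0,0,1,0,0,1,0,0,1,1], [0,0,1,1,0,1,1,0,1,1]),
    ([0,0,1,0,0,1,1,0,1,0], [0,0,1,1,0,1,0,0,1,0]),
    ([0,0,1,0,0,1,1,0,1,0], [0,0,1,1,1,0,0,0,1,0]),
    ([0,0,1,0,0,1,1,1,0,0], [0,0,1,1,1,0,0,1,0,0]),
    ([0,0,1,0,1,0,0,0,1,1], [0,0,1,1,0,0,1,0,1,1]),
    ([0,0,1,0,1,0,1,1,0,0], [0,0,1,1,1,1,0,1,0,0]),
    ([0,0,1,0,1,0,1,1,1,0], [0,0,1,1,0,0,0,1,1,0]),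
    ([0,1,0,0,0,1,0,1,0,1], [0,1,0,1,0,0,1,1,0,1]),
    ([0,1,0,0,1,1,0,0,1,0], [0,1,0,1,0,1,1,0,1,0]),
    ([0,1,1,0,0,1,1,1,1,0], [0,1,1,1,1,1,0,1,1,0]),
    ([0,1,1,0,1,1,0,0,0,1], [0,1,1,1,0,0,1,0,0,1]),
    ([0,0,0,0,0,1,0,0,0,0,1], [0,0,0,1,1,0,0,1,0,0,1]),
    ([0,0,0,0,0,1,0,0,1,0,0], [0,0,0,1,1,0,1,1,1,0,0]),
    ([0,0,0,0,0,1,1,1,0,0,0], [0,0,0,1,1,1,0,0,0,0,0]),
    ([0,0,0,0,1,0,0,1,0,0,1], [0,0,0,1,1,0,1,0,0,0,1]),
    ([0,0,0,0,1,0,0,1,0,0,1], [0,0,0,1,1,1,1,0,0,0,1]),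
    ([0,0,0,0,1,0,1,0,0,0,0], [0,0,0,1,1,1,1,1,0,0,0]),
    ([0,0,1,0,0,0,0,0,0,1,0], [0,0,1,1,0,1,1,1,0,1,0]),
    ([0,0,1,0,0,1,1,1,0,1,0], [0,0,1,1,1,0,1,0,0,1,0]),
    ([0,0,1,0,0,1,1,1,1,0,1], [0,0,1,1,1,1,1,0,1,0,1]),
    ([0,0,1,0,1,0,0,0,0,1,1], [0,0,1,1,0,1,0,1,0,1,1]),
    ([0,0,1,0,1,0,1,0,0,1,1], [0,0,1,1,1,0,0,1,0,1,1]),
    ([0,0,1,0,1,1,0,1,0,1,0], [0,0,1,1,0,1,0,0,0,1,0]),
    ([0,1,0,0,0,0,1,0,1,0,1], [0,1,0,1,0,1,0,1,1,0,1]),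
    ([0,1,0,0,0,0,1,1,0,1,0], [0,1,0,1,0,1,0,0,0,1,0]),
    ([0,1,0,0,0,1,0,1,0,0,1], [0,1,0,1,1,1,1,0,0,0,1]),
    ([0,1,0,0,0,1,1,1,1,1,0], [0,1,0,1,1,0,1,0,1,1,0]),
    ([0,1,0,0,1,0,1,0,1,1,0], [0,1,0,1,1,1,0,1,1,1,0]),
    ([0,1,0,0,1,1,1,1,0,0,1], [0,1,0,1,1,0,1,0,0,0,1]),
    ([0,1,1,0,1,1,1,0,1,1,0], [0,1,1,1,0,0,1,1,1,1,0]),
    ([0,0,1,0,0,1,1,1,0,0,1,0], [0,0,1,1,0,0,1,0,1,0,1,0])])"

lemma diamonds_are_diamonds: "\<forall>(P, Q)\<in>set diamonds. diamond 3 P Q"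
  by code_simp

text \<open>A formula \<open>P\<close> together with the variables that are still to be assigned.
  Repeated use of \<open>branch_split\<close>, each time followed by simplification, walks through a
  decision tree and closes a branch as soon as the values chosen on it make \<open>P\<close>
  true.\<close>

definition branch :: "bit list \<Rightarrow> bool \<Rightarrow> bool" where
  "branch hs P = P"

lemma branch_split:
  "(h = 0 \<Longrightarrow> branch hs P) \<Longrightarrow> (h = 1 \<Longrightarrow> branch hs P) \<Longrightarrow> branch (h # hs) P"
  unfolding branch_def by (cases h) auto

lemma branchD: "branch hs P \<Longrightarrow> P"
  by (simp add: branch_def)

lemma branch_True: "branch hs True"
  by (simp add: branch_def)

lemma all_bit: "(\<forall>b :: bit. P b) \<longleftrightarrow> P 0 \<and> P 1"
  by (metis bit.exhaust)

lemma bit_simps: "(1 :: bit) + 0 = 1" "(1 :: bit) + 1 = 0" "((0 :: bit) = 1) = False" "((1 :: bit) = 0) = False"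
  by simp_all

lemma image_word_3:
  "image_word 3 H [a, b, c] = []"
  "image_word 3 H (a # b # c # d # w) = H [a, b, c, d] # image_word 3 H (b # c # d # w)"
  by (simp_all add: eval_nat_numeral)

text \<open>A finite search over the \<open>2 ^ 15\<close> rules with \<open>H [0, 0, 0, 0] =
  0\<close>. The values of the rule are named by variables, in which the claim becomes a
  propositional formula. Only equalities between values occur in it, so a few values often decide
  it.\<close>

lemma diamond_or_separated_normalized:
  assumes table: "H [0,0,0,0] = 0" "H [0,0,0,1] = h1" "H [0,0,1,0] = h2" "H [0,0,1,1] = h3"
      "H [0,1,0,0] = h4" "H [0,1,0,1] = h5" "H [0,1,1,0] = h6" "H [0,1,1,1] = h7"
      "H [1,0,0,0] = h8" "H [1,0,0,1] = h9" "H [1,0,1,0] = h10" "H [1,0,1,1] = h11"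
      "H [1,1,0,0] = h12" "H [1,1,0,1] = h13" "H [1,1,1,0] = h14" "H [1,1,1,1] = h15"
  shows "(\<exists>(P, Q)\<in>set diamonds. image_word 3 H P = image_word 3 H Q) \<or>
    (\<forall>a b c. separated H 2 [a, b, c, 0] [a, b, c, 1]) \<or>
    (\<forall>a b c. separated (\<lambda>w. H (rev w)) 2 [a, b, c, 0] [a, b, c, 1])"
  \<comment> \<open>The order of the variables keeps the decision tree small; a local search found it.\<close>
  apply (rule branchD[of "[h4, h2, h8, h9, h1, h3, h6, h12, h5, h10, h11, h13, h14, h7, h15]"])
  apply (simp only: diamonds_def list.map concat.simps rev.simps append.simps case_prod_conv bit_simps)
  apply (simp only: list.set bex_simps case_prod_conv image_word_3 list.inject table)
  apply (simp only: numeral_2_eq_2 separated.simps all_bit list.sel rev.simps append.simps table)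
  apply (simp only: table bit_simps simp_thms)
  by ((rule branch_split; (simp only: bit_simps simp_thms branch_True)?)+)

lemma separated_translate: "separated (\<lambda>w. H w + c) k a b = separated H k a b"
  by (induction k arbitrary: a b) (simp_all only: separated.simps add_right_cancel)

lemma image_word_translate: "image_word r (\<lambda>w. H w + c) w = map (\<lambda>b. b + c) (image_word r H w)"
  by (induction w) simp_all

text \<open>Adding a constant to a rule changes neither which words have the same image nor whether
  it is closing, so the normalization is harmless.\<close>

theorem diamond_or_closing:
  "(\<exists>P Q. diamond 3 P Q \<and> image_word 3 H P = image_word 3 H Q) \<or>
   right_closing 3 2 H \<or> right_closing 3 2 (\<lambda>w. H (rev w))"
proof -
  have closing: "right_closing 3 2 G" if "\<forall>a b c. separated G 2 [a, b, c, 0] [a, b, c, 1]" for G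
  proof (rule right_closing_if_separated)
    fix u :: "bit list" assume "length u = 3"
    then obtain a b c where "u = [a, b, c]"
      by (auto simp: length_Suc_conv eval_nat_numeral)
    then show "separated G 2 (u @ [0]) (u @ [1])" using that by simp
  qed
  define H' where "H' w = H w + H [0,0,0,0]" for w
  have "inj (\<lambda>b. b + H [0,0,0,0])"
    by (rule injI) (simp only: add_right_cancel)
  then have image: "image_word 3 H' P = image_word 3 H' Q \<longleftrightarrow> image_word 3 H P = image_word 3 H Q" for P Q
    unfolding H'_def image_word_translate by (simp add: inj_map_eq_map)
  have "H' [0,0,0,0] = 0"
    by (cases "H [0,0,0,0]") (simp_all add: H'_def)
  from diamond_or_separated_normalized[of H', OF this refl refl refl refl refl refl refl refl refl refl refl refl refl refl refl]
  show ?thesis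
  proof (elim disjE)
    assume "\<exists>(P, Q)\<in>set diamonds. image_word 3 H' P = image_word 3 H' Q"
    then show ?thesis using diamonds_are_diamonds image by fastforce
  next
    assume "\<forall>a b c. separated H' 2 [a, b, c, 0] [a, b, c, 1]"
    then show ?thesis unfolding H'_def separated_translate using closing by blast
  next
    assume "\<forall>a b c. separated (\<lambda>w. H' (rev w)) 2 [a, b, c, 0] [a, b, c, 1]"
    then show ?thesis unfolding H'_def separated_translate using closing by blast
  qed
qed

section \<open>Density for span 4\<close>

theorem surj_width_4_dense:
  assumes "surj (sliding_block_code 3 H s)"
  shows "m_dense m {x. jointly_periodic (sliding_block_code 3 H s) x}"
  using diamond_or_closing[of H] surj_no_diamond[OF assms] right_closing_dense left_closing_dense
  by blast

text \<open>The reduced polynomial only involves four consecutive variables, so its evaluation is a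
  rule on the window that starts at the least index in use, even if the given window
  \<open>a..b\<close> is larger.\<close>

lemma span_4_sliding_block_code:
  assumes "has_span f 4"
  obtains H s where "f = sliding_block_code 3 H s"
proof -
  obtain a b F P where F: "is_local_rule f a b F" and P: "is_rule_poly a b F P" and ne: "\<Union>P \<noteq> {}"
    and span: "int 4 = 1 + Max {j - k | j k. j \<in> \<Union>P \<and> k \<in> \<Union>P}"
    using assms unfolding has_span_def by blast
  define s where "s = Min (\<Union>P)"
  have fin: "finite (\<Union>P)"
    by (rule finite_subset[of _ "{a..b}"]) (use P in \<open>auto simp: is_rule_poly_def\<close>)
  have diffs: "{j - k | j k. j \<in> \<Union>P \<and> k \<in> \<Union>P} = (\<lambda>(j, k). j - k) ` (\<Union>P \<times> \<Union>P)"
    by auto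
  have "s \<in> \<Union>P" unfolding s_def using fin ne by (rule Min_in)
  have window_range: "s \<le> j \<and> j \<le> s + 3" if "j \<in> \<Union>P" for j
  proof
    show "s \<le> j" unfolding s_def using fin that by (rule Min_le)
    have "j - s \<le> Max {j - k | j k. j \<in> \<Union>P \<and> k \<in> \<Union>P}"
    proof (rule Max_ge)
      show "finite {j - k | j k. j \<in> \<Union>P \<and> k \<in> \<Union>P}"
        unfolding diffs by (intro finite_imageI finite_cartesian_product fin)
      show "j - s \<in> {j - k | j k. j \<in> \<Union>P \<and> k \<in> \<Union>P}"
        using that \<open>s \<in> \<Union>P\<close> by blast
    qed
    then show "j \<le> s + 3" using span by simp
  qed
  define H where "H w = eval_poly2 P (\<lambda>j. w ! nat (j - s))" for w
  have "f x i = sliding_block_code 3 H s x i" for x i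
  proof -
    have "f x i = eval_poly2 P (\<lambda>j. x (i + j))"
      using F P by (simp add: is_local_rule_def is_rule_poly_def)
    also have "\<dots> = eval_poly2 P (\<lambda>j. window x (i + s) 4 ! nat (j - s))"
      unfolding eval_poly2_def
    proof (intro sum.cong prod.cong refl)
      fix M j assume "M \<in> P" "j \<in> M"
      then have "s \<le> j" "j \<le> s + 3" using window_range by blast+
      then show "x (i + j) = window x (i + s) 4 ! nat (j - s)"
        by (simp add: nth_window)
    qed
    finally show ?thesis by (simp add: sliding_block_code_def H_def)
  qed
  then show thesis using that by blast
qed

theorem proposition5p1:
  fixes f :: "config \<Rightarrow> config"
  assumes "cellular_automaton f"
    and "has_span f 4"
    and "surj f"
  shows "m_dense 13 {x. jointly_periodic f x}"
proof -
  obtain H s where "f = sliding_block_code 3 H s"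
    using span_4_sliding_block_code[OF assms(2)] .
  with assms(3) show ?thesis using surj_width_4_dense by blast
qed

end
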